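(* Let $G$ be a nonempty graph (i.e., a graph with at least one edge) with $n$ vertices and maximum degree $\Delta$. Then $$\operatorname{th}_{\gamma_P}(G)\ge\left\lceil 2\sqrt{\frac{n}{\Delta}}-\frac{1}{\Delta}\right\rceil,$$ and this bound is tight (there exist graphs attaining equality).
   Context: All graphs are finite, simple, undirected, and have at least one vertex. For $S\subseteq V(G)$, $N[S]$ is the set of vertices in $S$ or adjacent to a vertex of $S$. Given $G=(V,E)$ and $S\subseteq V$, initially (timestep $0$) the vertices of $S$ are colored; in timestep $1$ every vertex in $N[S]$ becomes colored; in each subsequent timestep, every vertex which is the only non-colored neighbor of some colored vertex becomes colored. $S$ is a power dominating set if all vertices eventually become colored, and then $\operatorname{ppt}(G;S)$ is the number of timesteps needed to color all of $G$ (so $\operatorname{ppt}(G;V)=0$). The power domination throttling number is $\operatorname{th}_{\gamma_P}(G)=\min\{|S|+\operatorname{ppt}(G;S): S \text{ a power dominating set of } G\}$. *)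

theory Defs
  imports Complex_Main "Graph_Theory.Pair_Digraph"
begin

text \<open>
  The locale \<^locale>\<open>pair_graph\<close> describes finite simple undirected graphs: an undirected edge is
  represented by the two opposite arcs joining its ends, and there are no loops.  The locale
  admits the graph without vertices, so nonemptiness of the vertex set has to be required separately.
\<close>

definition nbhd :: "'a pair_pre_digraph \<Rightarrow> 'a \<Rightarrow> 'a set" where
  "nbhd G v = {w. (v, w) \<in> parcs G}"

definition closed_nbhd :: "'a pair_pre_digraph \<Rightarrow> 'a set \<Rightarrow> 'a set" where
  "closed_nbhd G S = S \<union> (\<Union>v\<in>S. nbhd G v)"

definition max_degree :: "'a pair_pre_digraph \<Rightarrow> nat" where
  "max_degree G = Max ((\<lambda>v. card (nbhd G v)) ` pverts G)"

definition force_step :: "'a pair_pre_digraph \<Rightarrow> 'a set \<Rightarrow> 'a set" where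
  "force_step G C = C \<union> {w. \<exists>v\<in>C. nbhd G v - C = {w}}"

fun colored :: "'a pair_pre_digraph \<Rightarrow> 'a set \<Rightarrow> nat \<Rightarrow> 'a set" where
  "colored G S 0 = S"
| "colored G S (Suc 0) = closed_nbhd G S"
| "colored G S (Suc (Suc t)) = force_step G (colored G S (Suc t))"

definition power_dominating :: "'a pair_pre_digraph \<Rightarrow> 'a set \<Rightarrow> bool" where
  "power_dominating G S \<longleftrightarrow> S \<subseteq> pverts G \<and> (\<exists>t. colored G S t = pverts G)"

text \<open>Only meaningful when \<open>S\<close> is power dominating.\<close>

definition ppt :: "'a pair_pre_digraph \<Rightarrow> 'a set \<Rightarrow> nat" where
  "ppt G S = (LEAST t. colored G S t = pverts G)"

definition pd_throttling :: "'a pair_pre_digraph \<Rightarrow> nat" where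
  "pd_throttling G = Min {card S + ppt G S | S. power_dominating G S}"

end

theory Submission
  imports Defs
begin

text \<open>
  A colored vertex that colors another one in a timestep \<open>\<ge> 2\<close> still has a noncolored neighbor just
  before that timestep and none afterwards.  Hence the number of colored vertices with a noncolored
  neighbor never increases from timestep 1 on, and each timestep colors at most that many
  vertices.  At timestep 1 these vertices lie in \<open>N[S] - S\<close>, so there are at most \<open>\<Delta> |S|\<close> of them.
  This gives \<open>n \<le> |S| (1 + \<Delta> p)\<close> with \<open>p = ppt(G; S)\<close>, and the bound on \<open>|S| + p\<close> follows from the
  inequality of arithmetic and geometric means, applied to \<open>|S|\<close> and \<open>p + 1/\<Delta>\<close>.
  Equality holds for the complete graph on two vertices.
\<close>

definition active :: "'a pair_pre_digraph \<Rightarrow> 'a set \<Rightarrow> 'a set" where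
  "active G C = {v \<in> C. \<not> nbhd G v \<subseteq> C}"

context pair_graph
begin

lemma nbhd_subset: "nbhd G v \<subseteq> pverts G"
  unfolding nbhd_def using in_arcsD2 by auto

lemma finite_nbhd: "finite (nbhd G v)"
  using nbhd_subset finite_verts finite_subset by blast

lemma card_nbhd_le: "v \<in> pverts G \<Longrightarrow> card (nbhd G v) \<le> max_degree G"
  unfolding max_degree_def by (intro Max_ge) auto

lemma max_degree_pos:
  assumes "parcs G \<noteq> {}"
  shows "max_degree G > 0"
proof -
  obtain u v where uv: "(u, v) \<in> parcs G"
    using assms by auto
  then have "v \<in> nbhd G u"
    by (simp add: nbhd_def)
  then have "card (nbhd G u) > 0"
    using finite_nbhd card_gt_0_iff by blast
  then show ?thesis
    using card_nbhd_le[of u] in_arcsD1[OF uv] by simp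
qed

lemma closed_nbhd_subset: "S \<subseteq> pverts G \<Longrightarrow> closed_nbhd G S \<subseteq> pverts G"
  unfolding closed_nbhd_def using nbhd_subset by blast

lemma force_step_subset: "C \<subseteq> pverts G \<Longrightarrow> force_step G C \<subseteq> pverts G"
  unfolding force_step_def using nbhd_subset by blast

lemma colored_subset:
  assumes "S \<subseteq> pverts G"
  shows "colored G S t \<subseteq> pverts G"
proof (induction t)
  case 0
  show ?case using assms by simp
next
  case (Suc t)
  then show ?case
    using closed_nbhd_subset[OF assms] force_step_subset by (cases t) simp_all
qed

text \<open>Each newly colored vertex is charged to one vertex that forces it. The charge is
  injective because a forcing vertex has exactly one noncolored neighbor. Each forcing vertex then
  retires from the active set, and at most its target takes its place.\<close>

lemma card_force_step:
  assumes "C \<subseteq> pverts G"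
  shows "card (force_step G C) \<le> card C + card (active G C)"
    and "card (active G (force_step G C)) \<le> card (active G C)"
proof -
  define W where "W = force_step G C - C"
  have "finite C"
    by (rule finite_subset[OF assms finite_verts])
  moreover have "finite W"
    unfolding W_def by (intro finite_Diff finite_subset[OF force_step_subset[OF assms] finite_verts])
  ultimately have fin: "finite C" "finite (active G C)" "finite W"
    by (simp_all add: active_def)
  have "\<forall>w\<in>W. \<exists>v\<in>C. nbhd G v - C = {w}"
    by (auto simp: W_def force_step_def)
  \<comment> \<open>\<open>f w\<close> is a chosen vertex forcing \<open>w\<close>. Several vertices
    may force the same \<open>w\<close>; one is fixed.\<close>
  then obtain f where f: "\<And>w. w \<in> W \<Longrightarrow> f w \<in> C \<and> nbhd G (f w) - C = {w}"
    by metis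
  have inj: "inj_on f W"
    by (rule inj_onI) (metis f singleton_inject)
  have img: "f ` W \<subseteq> active G C"
    using f by (force simp: active_def)
  have W_le: "card W \<le> card (active G C)"
    using card_mono[OF fin(2) img] card_image[OF inj] by simp
  have step: "force_step G C = C \<union> W"
    by (auto simp: W_def force_step_def)
  show "card (force_step G C) \<le> card C + card (active G C)"
    using card_Un_le[of C W] W_le step by simp
  \<comment> \<open>All of the neighborhood of \<open>f w\<close> is colored after the step, so
    \<open>f w\<close> is no longer active. Only vertices of \<open>W\<close> can become active
    anew.\<close>
  have "nbhd G (f w) \<subseteq> C \<union> W" if "w \<in> W" for w
    using f[OF that] that by (simp flip: Diff_subset_conv)
  then have "active G (force_step G C) \<subseteq> (active G C - f ` W) \<union> W"
    unfolding step by (auto simp: active_def)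
  then have "card (active G (force_step G C)) \<le> card ((active G C - f ` W) \<union> W)"
    using fin by (intro card_mono) auto
  also have "\<dots> \<le> card (active G C - f ` W) + card W"
    by (rule card_Un_le)
  also have "\<dots> = card (active G C)"
    using fin img W_le card_image[OF inj] by (simp add: card_Diff_subset)
  finally show "card (active G (force_step G C)) \<le> card (active G C)" .
qed

lemma card_open_nbhd_le:
  assumes "S \<subseteq> pverts G"
  shows "card (\<Union>v\<in>S. nbhd G v) \<le> card S * max_degree G"
proof -
  have "card (\<Union>v\<in>S. nbhd G v) \<le> (\<Sum>v\<in>S. card (nbhd G v))"
    by (rule card_UN_le[OF finite_subset[OF assms finite_verts]])
  also have "\<dots> \<le> (\<Sum>v\<in>S. max_degree G)"
    using assms by (intro sum_mono card_nbhd_le) auto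
  finally show ?thesis by simp
qed

lemma card_active_closed_nbhd:
  assumes "S \<subseteq> pverts G"
  shows "card (active G (closed_nbhd G S)) \<le> card S * max_degree G"
proof -
  \<comment> \<open>A vertex of \<open>S\<close> has its whole neighborhood in
    \<open>closed_nbhd G S\<close>, so only neighbors of \<open>S\<close> can be active.\<close>
  have "active G (closed_nbhd G S) \<subseteq> (\<Union>v\<in>S. nbhd G v)"
    by (auto simp: active_def closed_nbhd_def)
  moreover have "finite (\<Union>v\<in>S. nbhd G v)"
    using finite_subset[OF assms finite_verts] finite_nbhd by blast
  ultimately have "card (active G (closed_nbhd G S)) \<le> card (\<Union>v\<in>S. nbhd G v)"
    by (intro card_mono)
  also have "\<dots> \<le> card S * max_degree G"
    by (rule card_open_nbhd_le[OF assms])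
  finally show ?thesis .
qed

text \<open>The count starts at timestep 1, since forcing steps only begin there; from then on
  \<open>card_force_step\<close> keeps it from growing.\<close>

lemma card_active_colored:
  assumes "S \<subseteq> pverts G"
  shows "card (active G (colored G S (Suc t))) \<le> card S * max_degree G"
proof (induction t)
  case 0
  show ?case using card_active_closed_nbhd[OF assms] by simp
next
  case (Suc t)
  show ?case
    using order_trans[OF card_force_step(2)[OF colored_subset[OF assms]] Suc] by simp
qed

lemma card_colored:
  assumes "S \<subseteq> pverts G"
  shows "card (colored G S t) \<le> card S * (1 + max_degree G * t)"
proof (induction t)
  case 0
  show ?case by simp
next
  case (Suc t)
  show ?case
  \<comment> \<open>The first timestep is a domination step and is bounded by the degrees in
    \<open>S\<close>; every later one is a forcing step, bounded by the active vertices. Both add at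
    most \<open>card S * max_degree G\<close>.\<close>
  proof (cases t)
    case 0
    then show ?thesis
      using card_Un_le[of S "\<Union>v\<in>S. nbhd G v"] card_open_nbhd_le[OF assms]
      by (simp add: closed_nbhd_def)
  next
    case (Suc s)
    then have "card (colored G S (Suc t)) \<le> card (colored G S t) + card S * max_degree G"
      using card_force_step(1)[OF colored_subset[OF assms, of t]] card_active_colored[OF assms, of s]
      by simp
    then show ?thesis
      using Suc.IH by (simp add: algebra_simps)
  qed
qed

lemma card_verts_le:
  assumes "power_dominating G S"
  shows "card (pverts G) \<le> card S * (1 + max_degree G * ppt G S)"
proof -
  have "colored G S (ppt G S) = pverts G"
    using assms LeastI_ex[of "\<lambda>t. colored G S t = pverts G"]
    by (simp add: power_dominating_def ppt_def)
  then show ?thesis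
    using card_colored[of S "ppt G S"] assms by (simp add: power_dominating_def)
qed

lemma finite_throttling_set: "finite {card S + ppt G S | S. power_dominating G S}"
proof -
  have "{card S + ppt G S | S. power_dominating G S} \<subseteq> (\<lambda>S. card S + ppt G S) ` Pow (pverts G)"
    by (auto simp: power_dominating_def)
  then show ?thesis
    by (rule finite_subset) (simp add: finite_verts)
qed

lemma pd_throttling_le: "power_dominating G S \<Longrightarrow> pd_throttling G \<le> card S + ppt G S"
  unfolding pd_throttling_def using finite_throttling_set by (intro Min_le) auto

lemma pd_throttling_attained:
  obtains S where "power_dominating G S" "pd_throttling G = card S + ppt G S"
proof -
  \<comment> \<open>The full vertex set is power dominating at time 0, so the minimum ranges over a
    nonempty set.\<close>
  have "power_dominating G (pverts G)"
    unfolding power_dominating_def by (intro conjI exI[of _ 0]) simp_all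
  then have "pd_throttling G \<in> {card S + ppt G S | S. power_dominating G S}"
    unfolding pd_throttling_def using finite_throttling_set by (intro Min_in) auto
  then show ?thesis
    using that by blast
qed

lemma pd_throttling_ge:
  assumes "parcs G \<noteq> {}"
  shows "\<lceil>2 * sqrt (real (card (pverts G)) / real (max_degree G)) - 1 / real (max_degree G)\<rceil>
    \<le> int (pd_throttling G)"
proof -
  obtain S where S: "power_dominating G S" "pd_throttling G = card S + ppt G S"
    by (rule pd_throttling_attained)
  define d k p where "d = real (max_degree G)" and "k = real (card S)" and "p = real (ppt G S)"
  have d: "d > 0"
    using max_degree_pos[OF assms] by (simp add: d_def)
  have "real (card (pverts G)) \<le> k * (1 + d * p)"
    using of_nat_mono[OF card_verts_le[OF S(1)], where 'a = real]
    by (simp add: d_def k_def p_def algebra_simps)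
  \<comment> \<open>Writing 1 + d p as d (p + 1/d) makes the two factors add up to the throttling
    number plus 1/d, which is the source of the term -1/d in the bound.\<close>
  then have "real (card (pverts G)) / d \<le> k * (p + 1 / d)"
    using d by (simp add: field_simps)
  then have "sqrt (real (card (pverts G)) / d) \<le> sqrt (k * (p + 1 / d))"
    by simp
  also have "\<dots> \<le> (k + (p + 1 / d)) / 2"
    using d by (intro arith_geo_mean_sqrt) (auto simp: k_def p_def)
  \<comment> \<open>The throttling number is an integer, so the real bound passes to its
    ceiling.\<close>
  finally show ?thesis
    using S(2) by (simp add: d_def k_def p_def ceiling_le_iff)
qed

end

definition edge_graph :: "nat pair_pre_digraph" where
  "edge_graph = \<lparr>pverts = {0, 1}, parcs = {(0, 1), (1, 0)}\<rparr>"

lemma pair_graph_edge_graph: "pair_graph edge_graph"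
  by unfold_locales (auto simp: edge_graph_def symmetric_def sym_def)

lemma nbhd_edge_graph: "nbhd edge_graph 0 = {1}" "nbhd edge_graph 1 = {0}"
  by (auto simp: nbhd_def edge_graph_def)

lemma max_degree_edge_graph: "max_degree edge_graph = 1"
  using nbhd_edge_graph by (simp add: max_degree_def edge_graph_def)

text \<open>One endpoint colors the other in the first timestep, at cost 1 + 1.\<close>

lemma pd_throttling_edge_graph: "pd_throttling edge_graph \<le> 2"
proof -
  have col: "colored edge_graph {0} 1 = pverts edge_graph"
    using nbhd_edge_graph by (simp add: closed_nbhd_def) (auto simp: edge_graph_def)
  then have "power_dominating edge_graph {0}"
    unfolding power_dominating_def by (intro conjI exI[of _ 1]) (simp_all add: edge_graph_def)
  moreover have "ppt edge_graph {0} \<le> 1"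
    unfolding ppt_def using col by (rule Least_le)
  ultimately show ?thesis
    using pair_graph.pd_throttling_le[OF pair_graph_edge_graph, of "{0}"] by simp
qed

lemma edge_graph_tight:
  "int (pd_throttling edge_graph) =
    \<lceil>2 * sqrt (real (card (pverts edge_graph)) / real (max_degree edge_graph))
      - 1 / real (max_degree edge_graph)\<rceil>" (is "_ = ?b")
proof -
  \<comment> \<open>Here n = 2 and the maximum degree is 1, so the bound is the ceiling of 2 sqrt 2
    - 1. This number exceeds 1, hence its ceiling is at least 2.\<close>
  have "1 < sqrt (2 :: real)"
    by simp
  then have "?b \<ge> 2"
    unfolding max_degree_edge_graph by (simp add: edge_graph_def le_ceiling_iff)
  moreover have "?b \<le> int (pd_throttling edge_graph)"
    by (rule pair_graph.pd_throttling_ge[OF pair_graph_edge_graph]) (simp add: edge_graph_def)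
  ultimately show ?thesis
    using pd_throttling_edge_graph by linarith
qed

theorem theorem5:
  shows "(\<forall>G :: 'a pair_pre_digraph.
            pair_graph G \<and> pverts G \<noteq> {} \<and> parcs G \<noteq> {} \<longrightarrow>
            int (pd_throttling G) \<ge>
              \<lceil>2 * sqrt (real (card (pverts G)) / real (max_degree G)) - 1 / real (max_degree G)\<rceil>)
       \<and> (\<exists>G :: nat pair_pre_digraph.
            pair_graph G \<and> pverts G \<noteq> {} \<and> parcs G \<noteq> {} \<and>
            int (pd_throttling G) =
              \<lceil>2 * sqrt (real (card (pverts G)) / real (max_degree G)) - 1 / real (max_degree G)\<rceil>)"
proof (intro conjI allI impI)
  show "\<lceil>2 * sqrt (real (card (pverts G)) / real (max_degree G)) - 1 / real (max_degree G)\<rceil>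
      \<le> int (pd_throttling G)"
    if "pair_graph G \<and> pverts G \<noteq> {} \<and> parcs G \<noteq> {}" for G :: "'a pair_pre_digraph"
    using that pair_graph.pd_throttling_ge by blast
  show "\<exists>G :: nat pair_pre_digraph.
            pair_graph G \<and> pverts G \<noteq> {} \<and> parcs G \<noteq> {} \<and>
            int (pd_throttling G) =
              \<lceil>2 * sqrt (real (card (pverts G)) / real (max_degree G)) - 1 / real (max_degree G)\<rceil>"
    using pair_graph_edge_graph edge_graph_tight
    by (intro exI[of _ edge_graph]) (simp add: edge_graph_def)
qed

end
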